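(* Let $A,B\in\mathcal{B}(\mathcal{H})$ be two strictly positive operators such that $$\tau(A)\cap\tau\left(\frac{A+B}{2}\right)=\varnothing\quad\text{and}\quad\tau(B)\cap\tau\left(\frac{A+B}{2}\right)=\varnothing.$$ Then $$2^{1-r}(A+B)^r\le A^r+B^r\quad\text{for all real } r>1\text{ and all real } r<0,$$ and $$A^r+B^r\le2^{1-r}(A+B)^r\quad\text{for all } r\in[0,1].$$
   Context: $\mathcal{B}(\mathcal{H})$ is the algebra of bounded linear operators on a complex Hilbert space $\mathcal{H}$. An operator $A$ is positive if $\langle Ax,x\rangle\ge0$ for all $x\in\mathcal{H}$, and strictly positive if it is positive and invertible. For self-adjoint operators, $A\ge B$ means that $A-B$ is positive. For an operator $X\in\mathcal{B}(\mathcal{H})$ (here self-adjoint), $\tau(X)$ denotes the smallest closed interval containing the spectrum of $X$. Real powers of strictly positive operators are understood via the continuous functional calculus. *)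

theory Defs
  imports "HOL-Analysis.Analysis" "HOL-Computational_Algebra.Polynomial"
begin

text \<open>
  A complex Hilbert space is a complete real inner product space with a compatible complex scalar
  multiplication and a sesquilinear form (linear in the first argument) whose real part is the
  real inner product; hence \<open>norm x = sqrt (Re (cinner x x))\<close>, and completeness refers to this norm.
\<close>

class complex_hilbert_space = real_inner + banach +
  fixes scaleC :: "complex \<Rightarrow> 'a \<Rightarrow> 'a" (infixr \<open>*\<^sub>C\<close> 75)
    and cinner :: "'a \<Rightarrow> 'a \<Rightarrow> complex"
  assumes scaleC_add_right: "c *\<^sub>C (x + y) = c *\<^sub>C x + c *\<^sub>C y"
    and scaleC_add_left: "(c + d) *\<^sub>C x = c *\<^sub>C x + d *\<^sub>C x"
    and scaleC_scaleC: "c *\<^sub>C (d *\<^sub>C x) = (c * d) *\<^sub>C x"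
    and scaleR_scaleC: "r *\<^sub>R x = complex_of_real r *\<^sub>C x"
    and cinner_commute: "cinner x y = cnj (cinner y x)"
    and cinner_add_left: "cinner (x + y) z = cinner x z + cinner y z"
    and cinner_scaleC_left: "cinner (c *\<^sub>C x) y = c * cinner x y"
    and inner_eq_Re_cinner: "inner x y = Re (cinner x y)"

lemma cinner_scaleC_right:
  fixes x y :: "'a::complex_hilbert_space"
  shows "cinner x (c *\<^sub>C y) = cnj c * cinner x y"
  by (metis cinner_commute cinner_scaleC_left complex_cnj_mult)

lemma norm_scaleC:
  fixes x :: "'a::complex_hilbert_space"
  shows "norm (c *\<^sub>C x) = cmod c * norm x"
proof -
  have "cinner (c *\<^sub>C x) (c *\<^sub>C x) = complex_of_real ((cmod c)\<^sup>2) * cinner x x"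
    by (simp add: cinner_scaleC_left cinner_scaleC_right complex_norm_square mult.assoc[symmetric]
        flip: of_real_power)
  then have "inner (c *\<^sub>C x) (c *\<^sub>C x) = (cmod c)\<^sup>2 * inner x x"
    by (simp add: inner_eq_Re_cinner flip: of_real_power)
  then show ?thesis
    by (simp add: norm_eq_sqrt_inner real_sqrt_mult)
qed

text \<open>
  Elements of \<open>B(H)\<close> are represented as those (real) bounded linear maps which are complex linear.
  The real and the complex operator norm of such a map agree.
\<close>

definition clinear_op :: "('a::complex_hilbert_space \<Rightarrow>\<^sub>L 'a) \<Rightarrow> bool" where
  "clinear_op A \<longleftrightarrow> (\<forall>c x. blinfun_apply A (c *\<^sub>C x) = c *\<^sub>C blinfun_apply A x)"

lift_definition scalar_op :: "complex \<Rightarrow> 'a::complex_hilbert_space \<Rightarrow>\<^sub>L 'a" is "\<lambda>c x. c *\<^sub>C x"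
proof -
  fix c :: complex
  show "bounded_linear (\<lambda>x::'a. c *\<^sub>C x)"
    by (rule bounded_linear_intro[where K = "cmod c"])
      (auto simp: scaleC_add_right scaleR_scaleC scaleC_scaleC norm_scaleC mult.commute)
qed

definition invertible_op :: "('a::complex_hilbert_space \<Rightarrow>\<^sub>L 'a) \<Rightarrow> bool" where
  "invertible_op A \<longleftrightarrow>
     (\<exists>T. clinear_op T \<and> T o\<^sub>L A = id_blinfun \<and> A o\<^sub>L T = id_blinfun)"

definition spectrum_op :: "('a::complex_hilbert_space \<Rightarrow>\<^sub>L 'a) \<Rightarrow> complex set" where
  "spectrum_op A = {z. \<not> invertible_op (A - scalar_op z)}"

definition positive_op :: "('a::complex_hilbert_space \<Rightarrow>\<^sub>L 'a) \<Rightarrow> bool" where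
  "positive_op A \<longleftrightarrow>
     clinear_op A \<and> (\<forall>x. cinner (blinfun_apply A x) x \<in> \<real>\<^sub>\<ge>\<^sub>0)"

definition strictly_positive_op :: "('a::complex_hilbert_space \<Rightarrow>\<^sub>L 'a) \<Rightarrow> bool" where
  "strictly_positive_op A \<longleftrightarrow> positive_op A \<and> invertible_op A"

definition le_op :: "('a::complex_hilbert_space \<Rightarrow>\<^sub>L 'a) \<Rightarrow> ('a \<Rightarrow>\<^sub>L 'a) \<Rightarrow> bool"
    (infix \<open>\<preceq>\<close> 50) where
  "A \<preceq> B \<longleftrightarrow> positive_op (B - A)"

text \<open>
  The smallest closed interval containing the spectrum. This is meant for operators with real
  spectrum, in particular self-adjoint ones.
\<close>

definition tau :: "('a::complex_hilbert_space \<Rightarrow>\<^sub>L 'a) \<Rightarrow> real set" where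
  "tau A = \<Inter>{I. (\<exists>a b. I = {a..b}) \<and> spectrum_op A \<subseteq> complex_of_real ` I}"

text \<open>
  Continuous functional calculus of a self-adjoint operator \<open>A\<close> for a real function \<open>f\<close> continuous
  on the spectrum: \<open>f(A)\<close> is the operator norm limit of \<open>p\<^sub>n(A)\<close>, for all sequences of real polynomials
  \<open>p\<^sub>n\<close> that converge to \<open>f\<close> uniformly on the spectrum. Such sequences exist by the Weierstrass
  approximation theorem, so there is at most one such operator; it exists because the norm of \<open>p(A)\<close>
  is the supremum of \<open>\<bar>p\<bar>\<close> over the spectrum.
\<close>

definition power_op :: "('a::complex_hilbert_space \<Rightarrow>\<^sub>L 'a) \<Rightarrow> nat \<Rightarrow> ('a \<Rightarrow>\<^sub>L 'a)" where
  "power_op A n = ((\<lambda>T. A o\<^sub>L T) ^^ n) id_blinfun"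

definition poly_op :: "real poly \<Rightarrow> ('a::complex_hilbert_space \<Rightarrow>\<^sub>L 'a) \<Rightarrow> ('a \<Rightarrow>\<^sub>L 'a)" where
  "poly_op p A = (\<Sum>i\<le>degree p. coeff p i *\<^sub>R power_op A i)"

definition cfc :: "(real \<Rightarrow> real) \<Rightarrow> ('a::complex_hilbert_space \<Rightarrow>\<^sub>L 'a) \<Rightarrow> ('a \<Rightarrow>\<^sub>L 'a)" where
  "cfc f A = (THE T. \<forall>p :: nat \<Rightarrow> real poly.
     uniform_limit {t. complex_of_real t \<in> spectrum_op A} (\<lambda>n. poly (p n)) f sequentially
       \<longrightarrow> (\<lambda>n. poly_op (p n) A) \<longlonglongrightarrow> T)"

text \<open>
  Only used for strictly positive \<open>A\<close>, whose spectrum lies in the open positive half-line, where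
  \<open>t powr r\<close> is the usual (continuous) real power.
\<close>

definition powr_op :: "('a::complex_hilbert_space \<Rightarrow>\<^sub>L 'a) \<Rightarrow> real \<Rightarrow> ('a \<Rightarrow>\<^sub>L 'a)" where
  "powr_op A r = cfc (\<lambda>t. t powr r) A"

end

theory Submission
  imports Defs "HOL-Computational_Algebra.Fundamental_Theorem_Algebra"
begin

text \<open>
  For \<open>f(t) = \<plusminus>t\<^sup>r\<close> convex, let \<open>l\<close> be the chord of \<open>f\<close> over \<open>\<tau>((A + B) / 2)\<close> (a tangent, if this
  interval is a point). Then \<open>f \<le> l\<close> on the spectrum of \<open>(A + B) / 2\<close>, while \<open>f \<ge> l\<close> on the spectra
  of \<open>A\<close> and \<open>B\<close>, which lie outside the interval. As \<open>l\<close> is affine,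
  \<open>f(A) + f(B) \<ge> l(A) + l(B) = 2 l((A + B) / 2) \<ge> 2 f((A + B) / 2)\<close>.
  The functional calculus preserves such inequalities because a real polynomial that is nonnegative on
  the spectrum of a self-adjoint operator yields a positive operator.
\<close>

section \<open>Complex scalars and complex linear operators\<close>

lemma scalar_op_apply [simp]: "blinfun_apply (scalar_op c) x = c *\<^sub>C x"
  by (simp add: scalar_op.rep_eq)

lemma scaleC_one [simp]: "1 *\<^sub>C x = (x::'a::complex_hilbert_space)"
  using scaleR_scaleC[of 1 x] by simp

lemma scaleC_zero_left [simp]: "0 *\<^sub>C x = (0::'a::complex_hilbert_space)"
  using scaleR_scaleC[of 0 x] by simp

lemma scaleC_minus_left: "(- c) *\<^sub>C x = - (c *\<^sub>C (x::'a::complex_hilbert_space))"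
  using scaleC_add_left[of "- c" c x] by (simp add: eq_neg_iff_add_eq_0)

lemma scaleC_zero_right [simp]: "c *\<^sub>C 0 = (0::'a::complex_hilbert_space)"
  by (metis blinfun.zero_right scalar_op_apply)

lemma scaleC_diff_right: "c *\<^sub>C (x - y) = c *\<^sub>C x - c *\<^sub>C (y::'a::complex_hilbert_space)"
  using blinfun.diff_right[of "scalar_op c" x y] by simp

lemma scaleC_scaleR: "c *\<^sub>C (r *\<^sub>R x) = r *\<^sub>R (c *\<^sub>C (x::'a::complex_hilbert_space))"
  by (simp add: scaleR_scaleC scaleC_scaleC mult.commute)

lemma inner_scaleC_ii:
  "inner (\<i> *\<^sub>C x) y = - Im (cinner x y)" "inner x (\<i> *\<^sub>C y) = Im (cinner x y)"
  by (simp_all add: inner_eq_Re_cinner cinner_scaleC_left cinner_scaleC_right)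

lemma Im_cinner_self [simp]: "Im (cinner x x) = 0"
proof -
  have "Im (cinner x x) = Im (cnj (cinner x x))"
    by (metis cinner_commute)
  then show ?thesis by simp
qed

lemma clinear_op_scaleC: "clinear_op A \<Longrightarrow> blinfun_apply A (c *\<^sub>C x) = c *\<^sub>C blinfun_apply A x"
  by (simp add: clinear_op_def)

lemma clinear_op_scalar_op: "clinear_op (scalar_op c)"
  by (simp add: clinear_op_def scaleC_scaleC mult.commute)

lemma clinear_op_id: "clinear_op id_blinfun"
  by (simp add: clinear_op_def)

lemma clinear_op_zero: "clinear_op 0"
  by (simp add: clinear_op_def)

lemma clinear_op_add: "clinear_op A \<Longrightarrow> clinear_op B \<Longrightarrow> clinear_op (A + B)"
  by (simp add: clinear_op_def blinfun.add_left scaleC_add_right)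

lemma clinear_op_diff: "clinear_op A \<Longrightarrow> clinear_op B \<Longrightarrow> clinear_op (A - B)"
  by (simp add: clinear_op_def blinfun.diff_left scaleC_diff_right)

lemma clinear_op_scaleR: "clinear_op A \<Longrightarrow> clinear_op (r *\<^sub>R A)"
  by (simp add: clinear_op_def blinfun.scaleR_left scaleC_scaleR)

lemma clinear_op_compose: "clinear_op A \<Longrightarrow> clinear_op B \<Longrightarrow> clinear_op (A o\<^sub>L B)"
  by (simp add: clinear_op_def)

lemmas clinear_op_intros =
  clinear_op_scalar_op clinear_op_id clinear_op_zero clinear_op_add clinear_op_diff
  clinear_op_scaleR clinear_op_compose

lemma clinear_op_limit:
  assumes "\<And>n. clinear_op (X n)" "X \<longlonglongrightarrow> T"
  shows "clinear_op T"
  unfolding clinear_op_def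
proof (intro allI)
  fix c x
  have "(\<lambda>n. X n (c *\<^sub>C x)) \<longlonglongrightarrow> T (c *\<^sub>C x)"
    by (intro tendsto_intros assms)
  moreover have "(\<lambda>n. scalar_op c (X n x)) \<longlonglongrightarrow> scalar_op c (T x)"
    by (intro tendsto_intros assms)
  ultimately show "T (c *\<^sub>C x) = c *\<^sub>C T x"
    using assms(1) by (simp add: clinear_op_scaleC LIMSEQ_unique)
qed

section \<open>Invertibility and coercive operators\<close>

lemma invertible_op_iff:
  "invertible_op A \<longleftrightarrow> (\<exists>T. clinear_op T \<and> (\<forall>x. T (A x) = x) \<and> (\<forall>x. A (T x) = x))"
  unfolding invertible_op_def
  by (metis blinfun_apply_blinfun_compose blinfun_apply_id_blinfun blinfun_eqI)

lemma invertible_op_compose: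
  assumes "invertible_op A" "invertible_op B"
  shows "invertible_op (A o\<^sub>L B)"
proof -
  obtain S where S: "clinear_op S" "\<And>x. S (A x) = x" "\<And>x. A (S x) = x"
    using assms(1) unfolding invertible_op_iff by auto
  obtain T where T: "clinear_op T" "\<And>x. T (B x) = x" "\<And>x. B (T x) = x"
    using assms(2) unfolding invertible_op_iff by auto
  show ?thesis
    unfolding invertible_op_iff
    by (rule exI[of _ "T o\<^sub>L S"]) (simp add: S T clinear_op_compose)
qed

lemma invertible_scalar_op: "c \<noteq> 0 \<Longrightarrow> invertible_op (scalar_op c)"
  unfolding invertible_op_iff
  by (rule exI[of _ "scalar_op (inverse c)"]) (simp add: clinear_op_scalar_op scaleC_scaleC)

lemma invertible_op_scalar_compose:
  assumes "c \<noteq> 0"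
  shows "invertible_op (scalar_op c o\<^sub>L A) \<longleftrightarrow> invertible_op A"
proof
  assume "invertible_op (scalar_op c o\<^sub>L A)"
  then have "invertible_op (scalar_op (inverse c) o\<^sub>L (scalar_op c o\<^sub>L A))"
    using assms by (intro invertible_op_compose[OF invertible_scalar_op, of _ "scalar_op c o\<^sub>L A"]) auto
  also have "scalar_op (inverse c) o\<^sub>L (scalar_op c o\<^sub>L A) = A"
    using assms by (intro blinfun_eqI) (simp add: scaleC_scaleC)
  finally show "invertible_op A" .
next
  assume "invertible_op A"
  then show "invertible_op (scalar_op c o\<^sub>L A)"
    using assms by (intro invertible_op_compose invertible_scalar_op)
qed

text \<open>The Lax--Milgram lemma: \<open>x \<mapsto> x - t (W x - y)\<close> is a contraction for small \<open>t > 0\<close>.\<close>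

lemma coercive_invertible:
  fixes W :: "'a::complex_hilbert_space \<Rightarrow>\<^sub>L 'a"
  assumes W: "clinear_op W" and c: "c > 0"
    and coercive: "\<And>x. c * (norm x)\<^sup>2 \<le> inner (W x) x"
  shows "invertible_op W"
proof -
  have lower: "c * norm x \<le> norm (W x)" for x
  proof (cases "x = 0")
    case False
    have "c * norm x * norm x \<le> norm (W x) * norm x"
      using coercive[of x] norm_cauchy_schwarz[of "W x" x] by (simp add: power2_eq_square)
    then show ?thesis using False by simp
  qed simp
  \<comment> \<open>Adding \<open>c\<close> ensures \<open>K > 0\<close> and
    \<open>c \<le> K\<close>, so that the square root in \<open>q\<close> has a nonnegative
    argument.\<close>
  define K where "K = norm W + c"
  have K: "K > 0" "c \<le> K" "\<And>x. norm (W x) \<le> K * norm x"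
  proof -
    show "norm (W x) \<le> K * norm x" for x
      using norm_blinfun[of W x] c mult_right_mono[of "norm W" K "norm x"] by (simp add: K_def)
  qed (use c in \<open>auto simp: K_def add_nonneg_pos\<close>)
  \<comment> \<open>The quadratic \<open>1 - 2 * t * c + t\<^sup>2 * K\<^sup>2\<close> in
    \<open>t\<close> is smallest here, and its minimum is \<open>q\<^sup>2\<close>.\<close>
  define t where "t = c / K\<^sup>2"
  define q where "q = sqrt (1 - c\<^sup>2 / K\<^sup>2)"
  have "c\<^sup>2 / K\<^sup>2 \<le> 1"
    using K c by (simp add: power_mono)
  then have q2: "q\<^sup>2 = 1 - c\<^sup>2 / K\<^sup>2" "0 \<le> q"
    by (simp_all add: q_def)
  have q1: "q < 1"
    using c K unfolding q_def by simp
  have contr: "norm (x - t *\<^sub>R W x) \<le> q * norm x" for x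
  proof -
    have t: "0 < t" using c K by (simp add: t_def)
    have "(norm (x - t *\<^sub>R W x))\<^sup>2 = (norm x)\<^sup>2 - 2 * t * inner (W x) x + t\<^sup>2 * (norm (W x))\<^sup>2"
      by (simp only: power2_norm_eq_inner)
        (simp add: inner_diff_left inner_diff_right inner_commute power2_eq_square)
    also have "\<dots> \<le> (norm x)\<^sup>2 - 2 * t * (c * (norm x)\<^sup>2) + t\<^sup>2 * (K * norm x)\<^sup>2"
      using t coercive[of x] K(3)[of x]
      by (intro add_mono diff_left_mono mult_left_mono power_mono) auto
    also have "\<dots> = (1 - 2 * t * c + t\<^sup>2 * K\<^sup>2) * (norm x)\<^sup>2"
      by (simp add: algebra_simps power_mult_distrib)
    also have "1 - 2 * t * c + t\<^sup>2 * K\<^sup>2 = 1 - c\<^sup>2 / K\<^sup>2"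
      using K by (simp add: t_def field_simps power2_eq_square)
    finally have "(norm (x - t *\<^sub>R W x))\<^sup>2 \<le> (q * norm x)\<^sup>2"
      by (simp add: q2 power_mult_distrib)
    then show ?thesis
      by (rule power2_le_imp_le) (use q2 in auto)
  qed
  have "\<exists>x. W x = y" for y
  proof -
    have "\<exists>!x. x - t *\<^sub>R (W x - y) = x"
    proof (rule banach_fix_type[OF q2(2) q1], intro allI)
      fix u v
      have "(u - t *\<^sub>R (W u - y)) - (v - t *\<^sub>R (W v - y)) = (u - v) - t *\<^sub>R W (u - v)"
        by (simp add: blinfun.diff_right algebra_simps)
      then show "dist (u - t *\<^sub>R (W u - y)) (v - t *\<^sub>R (W v - y)) \<le> q * dist u v"
        using contr[of "u - v"] by (simp only: dist_norm)
    qed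
    then obtain x where "t *\<^sub>R (W x - y) = 0" by auto
    then show ?thesis using c K by (auto simp: t_def)
  qed
  then obtain g where g: "\<And>y. W (g y) = y" by metis
  \<comment> \<open>Injectivity carries additivity, homogeneity and complex linearity over from
    \<open>W\<close> to its right inverse \<open>g\<close>.\<close>
  have inj: "x = y" if "W x = W y" for x y
    using lower[of "x - y"] that c by (simp add: blinfun.diff_right mult_le_0_iff)
  have "bounded_linear g"
  proof (rule bounded_linear_intro[where K = "1 / c"])
    show "g (x + y) = g x + g y" for x y
      by (rule inj) (simp add: g blinfun.add_right)
    show "g (r *\<^sub>R x) = r *\<^sub>R g x" for r x
      by (rule inj) (simp add: g blinfun.scaleR_right)
    show "norm (g x) \<le> norm x * (1 / c)" for x
      using lower[of "g x"] c by (simp add: g field_simps)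
  qed
  then have ap: "blinfun_apply (Blinfun g) = g"
    by (rule bounded_linear_Blinfun_apply)
  show ?thesis
    unfolding invertible_op_iff
  proof (intro exI[of _ "Blinfun g"] conjI allI)
    show "clinear_op (Blinfun g)"
      unfolding clinear_op_def ap by (intro allI, rule inj) (simp add: g W clinear_op_scaleC)
    show "Blinfun g (W x) = x" for x
      unfolding ap by (rule inj) (rule g)
    show "W (Blinfun g x) = x" for x
      unfolding ap by (rule g)
  qed
qed

text \<open>Coercivity only sees the real part of the numerical range; multiplication by
  \<open>u\<close> first turns that range into the right half-plane. This serves for nonreal
  spectral parameters and for real ones above the norm.\<close>

lemma rotated_coercive_invertible:
  assumes W: "clinear_op W" and c: "c > 0" and u: "u \<noteq> 0"
    and "\<And>x. c * (norm x)\<^sup>2 \<le> inner (u *\<^sub>C W x) x"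
  shows "invertible_op W"
proof -
  have "invertible_op (scalar_op u o\<^sub>L W)"
    by (rule coercive_invertible[OF _ c]) (use assms in \<open>auto intro: clinear_op_intros\<close>)
  then show ?thesis using u by (simp add: invertible_op_scalar_compose)
qed

section \<open>Self-adjoint and positive operators\<close>

definition selfadjoint_op :: "('a::complex_hilbert_space \<Rightarrow>\<^sub>L 'a) \<Rightarrow> bool" where
  "selfadjoint_op A \<longleftrightarrow> clinear_op A \<and> (\<forall>x y. inner (A x) y = inner x (A y))"

lemma selfadjoint_op_id: "selfadjoint_op id_blinfun"
  by (simp add: selfadjoint_op_def clinear_op_intros)

lemma selfadjoint_op_zero: "selfadjoint_op 0"
  by (simp add: selfadjoint_op_def clinear_op_intros)

lemma selfadjoint_op_add: "selfadjoint_op A \<Longrightarrow> selfadjoint_op B \<Longrightarrow> selfadjoint_op (A + B)"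
  by (simp add: selfadjoint_op_def clinear_op_intros blinfun.add_left inner_add_left inner_add_right)

lemma selfadjoint_op_diff: "selfadjoint_op A \<Longrightarrow> selfadjoint_op B \<Longrightarrow> selfadjoint_op (A - B)"
  by (simp add: selfadjoint_op_def clinear_op_intros blinfun.diff_left inner_diff_left inner_diff_right)

lemma selfadjoint_op_scaleR: "selfadjoint_op A \<Longrightarrow> selfadjoint_op (r *\<^sub>R A)"
  by (simp add: selfadjoint_op_def clinear_op_intros blinfun.scaleR_left)

lemma selfadjoint_op_limit:
  assumes "\<And>n. selfadjoint_op (X n)" "X \<longlonglongrightarrow> T"
  shows "selfadjoint_op T"
  unfolding selfadjoint_op_def
proof (intro conjI allI)
  show "clinear_op T"
    using assms clinear_op_limit[of X T] by (auto simp: selfadjoint_op_def)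
  fix x y
  have "(\<lambda>n. inner (X n x) y) \<longlonglongrightarrow> inner (T x) y" "(\<lambda>n. inner x (X n y)) \<longlonglongrightarrow> inner x (T y)"
    by (intro tendsto_intros assms)+
  then show "inner (T x) y = inner x (T y)"
    using assms(1) by (simp add: selfadjoint_op_def LIMSEQ_unique)
qed

text \<open>Symmetry is stated for the real inner product, which reaches the imaginary part through
  \<open>\<i>\<close>: on the pair \<open>\<i> *\<^sub>C x\<close> and \<open>x\<close>, its two
  sides are minus and plus the imaginary part of \<open>cinner (A x) x\<close>.\<close>

lemma selfadjoint_Im_cinner:
  assumes "selfadjoint_op A"
  shows "Im (cinner (A x) x) = 0"
proof -
  have "inner (A (\<i> *\<^sub>C x)) x = inner (\<i> *\<^sub>C x) (A x)"
    using assms by (simp add: selfadjoint_op_def)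
  moreover have "Im (cinner x (A x)) = - Im (cinner (A x) x)"
    by (subst cinner_commute) simp
  ultimately show ?thesis
    using assms by (simp add: selfadjoint_op_def clinear_op_scaleC inner_scaleC_ii)
qed

text \<open>Polarization: the form is real at \<open>x + y\<close>, so the imaginary parts of its
  cross terms cancel; with \<open>\<i> *\<^sub>C x\<close> in place of \<open>x\<close> this becomes
  symmetry of the real parts. Conversely, the quadratic form of a self-adjoint operator is
  real.\<close>

lemma positive_op_iff:
  "positive_op A \<longleftrightarrow> selfadjoint_op A \<and> (\<forall>x. 0 \<le> inner (A x) x)"
proof
  assume A: "positive_op A"
  then have lin: "clinear_op A" by (simp add: positive_op_def)
  have Im: "Im (cinner (A x) x) = 0" and Re: "0 \<le> Re (cinner (A x) x)" for x
    using A by (auto simp: positive_op_def complex_nonneg_Reals_iff)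
  have *: "Im (cinner (A x) y) + Im (cinner (A y) x) = 0" for x y
  proof -
    have r: "cinner u (v + w) = cinner u v + cinner u w" for u v w :: 'a
      by (metis cinner_commute cinner_add_left complex_cnj_add)
    have "Im (cinner (A (x + y)) (x + y)) = 0" by (rule Im)
    then show ?thesis
      by (simp add: blinfun.add_right cinner_add_left r Im)
  qed
  have "inner (A x) y = inner x (A y)" for x y
  proof -
    have "Im (cinner (A (\<i> *\<^sub>C x)) y) + Im (cinner (A y) (\<i> *\<^sub>C x)) = 0" by (rule *)
    then have "inner (A x) y = inner (A y) x"
      by (simp add: lin clinear_op_scaleC cinner_scaleC_left cinner_scaleC_right inner_eq_Re_cinner)
    then show ?thesis by (simp add: inner_commute)
  qed
  then show "selfadjoint_op A \<and> (\<forall>x. 0 \<le> inner (A x) x)"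
    using lin Re by (simp add: selfadjoint_op_def inner_eq_Re_cinner)
next
  assume A: "selfadjoint_op A \<and> (\<forall>x. 0 \<le> inner (A x) x)"
  then show "positive_op A"
    using selfadjoint_Im_cinner[of A]
    by (auto simp: positive_op_def selfadjoint_op_def complex_nonneg_Reals_iff inner_eq_Re_cinner)
qed

text \<open>Positivity gives \<open>(norm (A x))\<^sup>2 \<le> K * inner (A x) x\<close>, and the
  bounded inverse gives \<open>norm x \<le> L * norm (A x)\<close>; chained together they bound the
  form from below.\<close>

lemma positive_invertible_coercive:
  assumes A: "selfadjoint_op A" "\<And>x. 0 \<le> inner (A x) x" and inv: "invertible_op A"
  obtains c where "c > 0" "\<And>x. c * (norm x)\<^sup>2 \<le> inner (A x) x"
proof -
  define K where "K = norm A + 1"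
  have K: "K > 0" by (simp add: K_def add_nonneg_pos)
  have sq: "(norm (A x))\<^sup>2 \<le> K * inner (A x) x" for x
  proof -
    \<comment> \<open>The form is tested at \<open>x - t *\<^sub>R A x\<close>; this
      \<open>t\<close> minimizes \<open>t\<^sup>2 * K - 2 * t\<close> and so yields the sharpest
      bound.\<close>
    define t where "t = 1 / K"
    have "0 \<le> inner (A (x - t *\<^sub>R A x)) (x - t *\<^sub>R A x)" by (rule A)
    also have "inner (A (x - t *\<^sub>R A x)) (x - t *\<^sub>R A x) = inner (A x) x - 2 * t * (norm (A x))\<^sup>2 + t\<^sup>2 * inner (A (A x)) (A x)"
      using A(1) by (simp only: power2_norm_eq_inner)
        (simp add: selfadjoint_op_def blinfun.diff_right blinfun.scaleR_right inner_diff_left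
          inner_diff_right inner_commute power2_eq_square algebra_simps)
    finally have "0 \<le> inner (A x) x - 2 * t * (norm (A x))\<^sup>2 + t\<^sup>2 * inner (A (A x)) (A x)" .
    moreover have "inner (A (A x)) (A x) \<le> K * (norm (A x))\<^sup>2"
    proof -
      have "inner (A (A x)) (A x) \<le> norm (A (A x)) * norm (A x)" by (rule norm_cauchy_schwarz)
      also have "\<dots> \<le> (norm A * norm (A x)) * norm (A x)"
        by (intro mult_right_mono norm_blinfun) auto
      also have "\<dots> \<le> K * (norm (A x))\<^sup>2"
        by (simp add: K_def power2_eq_square algebra_simps)
      finally show ?thesis .
    qed
    ultimately have "2 * t * (norm (A x))\<^sup>2 \<le> inner (A x) x + t\<^sup>2 * (K * (norm (A x))\<^sup>2)"
      using mult_left_mono[of "inner (A (A x)) (A x)" "K * (norm (A x))\<^sup>2" "t\<^sup>2"] by simp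
    also have "t\<^sup>2 * (K * (norm (A x))\<^sup>2) = t * (norm (A x))\<^sup>2"
      using K by (simp add: t_def power2_eq_square)
    finally have "t * (norm (A x))\<^sup>2 \<le> inner (A x) x" by linarith
    then show ?thesis using K by (simp add: t_def field_simps)
  qed
  obtain T :: "'a \<Rightarrow>\<^sub>L 'a" where T: "\<And>x. T (A x) = x"
    using inv unfolding invertible_op_iff by metis
  define L where "L = norm T + 1"
  have L: "L > 0" by (simp add: L_def add_nonneg_pos)
  show ?thesis
  proof
    show "1 / (L\<^sup>2 * K) > 0" using K L by simp
    fix x
    have "norm x \<le> norm T * norm (A x)"
      using norm_blinfun[of T "A x"] T by simp
    also have "\<dots> \<le> L * norm (A x)"
      by (simp add: L_def mult_right_mono)
    finally have "norm x \<le> L * norm (A x)" .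
    then have "(norm x)\<^sup>2 \<le> L\<^sup>2 * (norm (A x))\<^sup>2"
      by (metis power_mono norm_ge_zero power_mult_distrib)
    also have "\<dots> \<le> L\<^sup>2 * (K * inner (A x) x)"
      using sq[of x] by (intro mult_left_mono) auto
    finally show "1 / (L\<^sup>2 * K) * (norm x)\<^sup>2 \<le> inner (A x) x"
      using K L by (simp add: field_simps)
  qed
qed

section \<open>Polynomials of an operator, with complex and with real coefficients\<close>

definition cpoly_op :: "complex poly \<Rightarrow> ('a::complex_hilbert_space \<Rightarrow>\<^sub>L 'a) \<Rightarrow> ('a \<Rightarrow>\<^sub>L 'a)" where
  "cpoly_op p A = fold_coeffs (\<lambda>a T. scalar_op a + (A o\<^sub>L T)) p 0"

lemma cpoly_op_0 [simp]: "cpoly_op 0 A = 0"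
  by (simp add: cpoly_op_def)

lemma cpoly_op_pCons: "cpoly_op (pCons a p) A = scalar_op a + (A o\<^sub>L cpoly_op p A)"
proof (cases "a = 0 \<and> p = 0")
  case True
  then show ?thesis by (auto simp: cpoly_op_def intro!: blinfun_eqI)
next
  case False
  then show ?thesis by (auto simp: cpoly_op_def)
qed

lemma cpoly_op_add: "cpoly_op (p + q) A = cpoly_op p A + cpoly_op q A"
proof (induction p q rule: poly_induct2)
  case (pCons a p b q)
  then show ?case
    by (auto simp: cpoly_op_pCons blinfun.add_left blinfun.add_right scaleC_add_left intro!: blinfun_eqI)
qed simp

lemma cpoly_op_smult:
  assumes "clinear_op A"
  shows "cpoly_op (smult c p) A = scalar_op c o\<^sub>L cpoly_op p A"
proof (induction p)
  case (pCons a p)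
  then show ?case
    using assms
    by (auto simp: cpoly_op_pCons blinfun.add_left scaleC_add_right scaleC_scaleC clinear_op_scaleC
        intro!: blinfun_eqI)
qed simp

lemma cpoly_op_linear_factor:
  assumes "clinear_op A"
  shows "cpoly_op ([:- z, 1:] * p) A = (A - scalar_op z) o\<^sub>L cpoly_op p A"
proof (rule blinfun_eqI)
  fix x
  have "[:- z, 1:] * p = smult (- z) p + pCons 0 p"
    by simp
  then show "cpoly_op ([:- z, 1:] * p) A x = ((A - scalar_op z) o\<^sub>L cpoly_op p A) x"
    using assms
    by (simp only: cpoly_op_add cpoly_op_smult cpoly_op_pCons)
      (simp add: blinfun.add_left blinfun.diff_left scaleC_minus_left)
qed

text \<open>The fundamental theorem of algebra splits off the roots one at a time, which is why
  \<open>cpoly_op\<close> takes complex coefficients. Each factor \<open>A - scalar_op z\<close> is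
  invertible because its root \<open>z\<close> avoids the spectrum.\<close>

lemma invertible_cpoly_op:
  assumes A: "clinear_op A"
  shows "p \<noteq> 0 \<Longrightarrow> (\<And>z. poly p z = 0 \<Longrightarrow> z \<notin> spectrum_op A) \<Longrightarrow> invertible_op (cpoly_op p A)"
proof (induction "degree p" arbitrary: p)
  case 0
  then obtain c where "p = [:c:]" "c \<noteq> 0"
    by (metis degree_eq_zeroE pCons_0_0)
  then show ?case
    by (simp add: cpoly_op_pCons invertible_scalar_op)
next
  case (Suc n)
  then have "\<not> constant (poly p)"
    by (simp add: constant_degree)
  then obtain z where z: "poly p z = 0"
    using fundamental_theorem_of_algebra by blast
  then obtain q where q: "p = [:- z, 1:] * q"
    by (metis poly_eq_0_iff_dvd dvdE)
  then have "q \<noteq> 0" using Suc.prems(1) by auto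
  then have "degree p = Suc (degree q)"
    unfolding q by (subst degree_mult_eq) auto
  then have "invertible_op (cpoly_op q A)"
    using Suc.hyps Suc.prems(2) \<open>q \<noteq> 0\<close> by (auto simp: q)
  moreover have "invertible_op (A - scalar_op z)"
    using Suc.prems(2)[OF z] by (simp add: spectrum_op_def)
  ultimately show ?case
    unfolding q cpoly_op_linear_factor[OF A] by (intro invertible_op_compose)
qed

lemmas blinfun_compose_right_simps =
  bounded_bilinear.add_right[OF bounded_bilinear_blinfun_compose]
  bounded_bilinear.scaleR_right[OF bounded_bilinear_blinfun_compose]
  bounded_bilinear.sum_right[OF bounded_bilinear_blinfun_compose]

lemma poly_op_0 [simp]: "poly_op 0 A = 0"
  by (simp add: poly_op_def)

text \<open>Horner's rule, on which the following inductions over \<open>pCons\<close> rest.\<close>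

lemma poly_op_pCons: "poly_op (pCons a p) A = a *\<^sub>R id_blinfun + (A o\<^sub>L poly_op p A)"
proof (cases "p = 0")
  case True
  then show ?thesis
    by (simp add: poly_op_def power_op_def)
next
  case False
  have "poly_op (pCons a p) A
      = a *\<^sub>R id_blinfun + (\<Sum>i\<le>degree p. coeff p i *\<^sub>R (A o\<^sub>L power_op A i))"
    using False by (simp add: poly_op_def sum.atMost_Suc_shift power_op_def del: sum.atMost_Suc)
  also have "(\<Sum>i\<le>degree p. coeff p i *\<^sub>R (A o\<^sub>L power_op A i)) = (A o\<^sub>L poly_op p A)"
    by (simp add: poly_op_def blinfun_compose_right_simps)
  finally show ?thesis .
qed

lemma poly_op_add: "poly_op (p + q) A = poly_op p A + poly_op q A"
proof (induction p q rule: poly_induct2)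
  case (pCons a p b q)
  then show ?case
    by (simp add: poly_op_pCons blinfun_compose_right_simps scaleR_left_distrib)
qed simp

lemma poly_op_smult: "poly_op (smult c p) A = c *\<^sub>R poly_op p A"
proof (induction p)
  case (pCons a p)
  then show ?case
    by (simp add: poly_op_pCons blinfun_compose_right_simps scaleR_right_distrib)
qed simp

lemma poly_op_diff: "poly_op (p - q) A = poly_op p A - poly_op q A"
  using poly_op_add[of "p - q" q A] by simp

lemma poly_op_const: "poly_op [:c:] A = c *\<^sub>R id_blinfun"
  by (simp add: poly_op_pCons)

lemma poly_op_linear: "poly_op [:b, a:] A = a *\<^sub>R A + b *\<^sub>R id_blinfun"
  by (auto simp: poly_op_pCons blinfun.add_left blinfun.scaleR_left blinfun.scaleR_right intro!: blinfun_eqI)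

text \<open>Lets a real polynomial in \<open>A\<close> be factored through its complex
  roots.\<close>

lemma poly_op_eq_cpoly_op: "poly_op p A = cpoly_op (map_poly of_real p) A"
proof (induction p)
  case (pCons a p)
  then show ?case
    by (auto simp: poly_op_pCons cpoly_op_pCons map_poly_pCons blinfun.add_left blinfun.scaleR_left
        scaleR_scaleC intro!: blinfun_eqI)
qed simp

text \<open>Moving the factors of \<open>A o\<^sub>L poly_op p A\<close> across the inner product
  reverses their order; commuting them restores it, so the product is again symmetric when
  \<open>A\<close> is.\<close>

lemma poly_op_commute: "A o\<^sub>L poly_op p A = poly_op p A o\<^sub>L A"
proof (induction p)
  case (pCons a p)
  show ?case
  proof (rule blinfun_eqI)
    fix x
    have "A (poly_op p A x) = poly_op p A (A x)" for x
      using pCons by (metis blinfun_apply_blinfun_compose)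
    then show "(A o\<^sub>L poly_op (pCons a p) A) x = (poly_op (pCons a p) A o\<^sub>L A) x"
      by (simp add: poly_op_pCons blinfun.add_left blinfun.add_right blinfun.scaleR_left blinfun.scaleR_right)
  qed
qed simp

lemma selfadjoint_poly_op:
  assumes A: "selfadjoint_op A"
  shows "selfadjoint_op (poly_op p A)"
proof (induction p)
  case (pCons a p)
  have "inner ((A o\<^sub>L poly_op p A) x) y = inner x ((A o\<^sub>L poly_op p A) y)" for x y
    using A pCons by (subst (2) poly_op_commute) (simp add: selfadjoint_op_def)
  then have "selfadjoint_op (A o\<^sub>L poly_op p A)"
    using A pCons by (simp add: selfadjoint_op_def clinear_op_intros)
  then show ?case
    unfolding poly_op_pCons
    by (intro selfadjoint_op_add selfadjoint_op_scaleR selfadjoint_op_id)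
qed (simp add: selfadjoint_op_zero)

section \<open>Numerical range and spectrum of self-adjoint operators\<close>

text \<open>The infimum of a negative numerical range would be a spectral value.\<close>

lemma form_nonneg_of_resolvent:
  fixes T :: "'a::complex_hilbert_space \<Rightarrow>\<^sub>L 'a"
  assumes T: "selfadjoint_op T"
    and inv: "\<And>l. l < 0 \<Longrightarrow> invertible_op (T - scalar_op (complex_of_real l))"
  shows "0 \<le> inner (T x) x"
proof (rule ccontr)
  assume neg: "\<not> 0 \<le> inner (T x) x"
  \<comment> \<open>The lower bounds of the Rayleigh quotient of \<open>T\<close>; their supremum
    \<open>l\<close> is its infimum.\<close>
  define S where "S = {c::real. \<forall>x. c * (norm x)\<^sup>2 \<le> inner (T x) x}"
  have "- norm T \<in> S"
  proof -
    have "- norm T * (norm y)\<^sup>2 \<le> inner (T y) y" for y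
    proof -
      have "\<bar>inner (T y) y\<bar> \<le> norm (T y) * norm y" by (rule Cauchy_Schwarz_ineq2)
      also have "\<dots> \<le> norm T * norm y * norm y" by (intro mult_right_mono norm_blinfun) auto
      finally show ?thesis by (simp add: power2_eq_square)
    qed
    then show ?thesis by (simp add: S_def)
  qed
  have x: "(norm x)\<^sup>2 > 0" using neg by auto
  have upper: "c \<le> inner (T x) x / (norm x)\<^sup>2" if "c \<in> S" for c
    using that x by (simp add: S_def pos_le_divide_eq)
  then have bdd: "bdd_above S" by (auto simp: bdd_above_def)
  define l where "l = Sup S"
  have "l \<le> inner (T x) x / (norm x)\<^sup>2"
    unfolding l_def using \<open>- norm T \<in> S\<close> upper by (intro cSup_least) auto
  also have "\<dots> < 0" using neg x by (simp add: divide_neg_pos)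
  finally have l: "l < 0" .
  have lS: "l * (norm y)\<^sup>2 \<le> inner (T y) y" for y
  proof (cases "y = 0")
    case False
    then have y: "(norm y)\<^sup>2 > 0" by simp
    have "l \<le> inner (T y) y / (norm y)\<^sup>2"
      unfolding l_def
    proof (rule cSup_least)
      show "S \<noteq> {}" using \<open>- norm T \<in> S\<close> by auto
    qed (use y in \<open>simp add: S_def pos_le_divide_eq\<close>)
    then show ?thesis using y by (simp add: pos_le_divide_eq)
  qed simp
  define W where "W = T - scalar_op (complex_of_real l)"
  have W: "W y = T y - l *\<^sub>R y" for y
    by (simp add: W_def blinfun.diff_left scaleR_scaleC)
  have Wform: "inner (W y) y = inner (T y) y - l * (norm y)\<^sup>2" for y
    by (simp add: W inner_diff_left power2_norm_eq_inner)
  have "selfadjoint_op W"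
    using T unfolding selfadjoint_op_def W_def
    by (auto intro: clinear_op_intros simp: blinfun.diff_left inner_diff_left inner_diff_right
        simp flip: scaleR_scaleC)
  moreover have "invertible_op W" using inv[OF l] by (simp add: W_def)
  \<comment> \<open>\<open>W\<close> is positive and invertible, hence coercive. This raises the
    lower bound \<open>l\<close> by some \<open>c > 0\<close>, against its maximality.\<close>
  ultimately obtain c where c: "c > 0" "\<And>y. c * (norm y)\<^sup>2 \<le> inner (W y) y"
    using positive_invertible_coercive[of W] lS Wform by auto
  have "(l + c) * (norm y)\<^sup>2 \<le> inner (T y) y" for y
    using c(2)[of y] Wform[of y] by (simp add: algebra_simps)
  then have "l + c \<in> S" by (simp add: S_def)
  then have "l + c \<le> l" unfolding l_def by (rule cSup_upper[OF _ bdd])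
  then show False using c by simp
qed

lemma spectrum_real:
  fixes A :: "'a::complex_hilbert_space \<Rightarrow>\<^sub>L 'a"
  assumes A: "selfadjoint_op A" and z: "z \<in> spectrum_op A"
  shows "Im z = 0"
proof (rule ccontr)
  assume b: "Im z \<noteq> 0"
  \<comment> \<open>Multiplication by plus or minus \<open>\<i>\<close> makes the real number
    \<open>cinner (A x) x\<close> purely imaginary, while the term with \<open>- z\<close> acquires
    the real part \<open>\<bar>Im z\<bar> * inner x x\<close>.\<close>
  define u where "u = \<i> * complex_of_real (sgn (Im z))"
  have "invertible_op (A - scalar_op z)"
  proof (rule rotated_coercive_invertible)
    show "clinear_op (A - scalar_op z)"
      using A by (auto simp: selfadjoint_op_def intro: clinear_op_intros)
    show "\<bar>Im z\<bar> > 0" "u \<noteq> 0" using b by (auto simp: u_def sgn_zero_iff)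
    fix x
    have "cinner (u *\<^sub>C (A - scalar_op z) x) x = u * (cinner (A x) x - z * cinner x x)"
      by (simp add: cinner_scaleC_left blinfun.diff_left)
        (metis (no_types) add_diff_cancel cinner_add_left cinner_scaleC_left diff_add_cancel)
    then have "inner (u *\<^sub>C (A - scalar_op z) x) x = Re (u * (cinner (A x) x - z * cinner x x))"
      by (simp only: inner_eq_Re_cinner)
    also have "\<dots> = sgn (Im z) * Im z * inner x x"
      using selfadjoint_Im_cinner[OF A, of x]
      by (simp add: inner_eq_Re_cinner u_def)
    finally have "inner (u *\<^sub>C (A - scalar_op z) x) x = sgn (Im z) * Im z * inner x x" .
    then show "\<bar>Im z\<bar> * (norm x)\<^sup>2 \<le> inner (u *\<^sub>C (A - scalar_op z) x) x"
      by (simp add: power2_norm_eq_inner abs_sgn mult.commute)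
  qed
  then show False using z by (simp add: spectrum_op_def)
qed

lemma spectrum_lower_bound:
  fixes A :: "'a::complex_hilbert_space \<Rightarrow>\<^sub>L 'a"
  assumes A: "selfadjoint_op A" and c: "\<And>x. c * (norm x)\<^sup>2 \<le> inner (A x) x"
    and t: "complex_of_real t \<in> spectrum_op A"
  shows "c \<le> t"
proof (rule ccontr)
  assume "\<not> c \<le> t"
  have "invertible_op (A - scalar_op (complex_of_real t))"
  proof (rule coercive_invertible)
    show "clinear_op (A - scalar_op (complex_of_real t))"
      using A by (auto simp: selfadjoint_op_def intro: clinear_op_intros)
    show "c - t > 0" using \<open>\<not> c \<le> t\<close> by simp
    show "(c - t) * (norm x)\<^sup>2 \<le> inner ((A - scalar_op (complex_of_real t)) x) x" for x
      using c[of x]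
      by (simp add: blinfun.diff_left inner_diff_left power2_norm_eq_inner algebra_simps
          flip: scaleR_scaleC)
  qed
  then show False using t by (simp add: spectrum_op_def)
qed

lemma spectrum_upper_bound:
  fixes A :: "'a::complex_hilbert_space \<Rightarrow>\<^sub>L 'a"
  assumes A: "selfadjoint_op A" and t: "complex_of_real t \<in> spectrum_op A"
  shows "t \<le> norm A"
proof (rule ccontr)
  assume "\<not> t \<le> norm A"
  have "invertible_op (A - scalar_op (complex_of_real t))"
  \<comment> \<open>With \<open>u = -1\<close> the form is that of \<open>t - A\<close>, which is
    bounded below by \<open>t - norm A\<close>.\<close>
  proof (rule rotated_coercive_invertible[where u = "-1"])
    show "clinear_op (A - scalar_op (complex_of_real t))"
      using A by (auto simp: selfadjoint_op_def intro: clinear_op_intros)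
    show "t - norm A > 0" using \<open>\<not> t \<le> norm A\<close> by simp
    fix x
    have "inner (A x) x \<le> norm (A x) * norm x" by (rule norm_cauchy_schwarz)
    also have "\<dots> \<le> norm A * norm x * norm x" by (intro mult_right_mono norm_blinfun) auto
    finally have "inner (A x) x \<le> norm A * inner x x"
      by (simp add: power2_eq_square flip: power2_norm_eq_inner)
    then show "(t - norm A) * (norm x)\<^sup>2 \<le> inner (-1 *\<^sub>C (A - scalar_op (complex_of_real t)) x) x"
      by (simp add: scaleC_minus_left blinfun.diff_left inner_diff_left power2_norm_eq_inner
          algebra_simps flip: scaleR_scaleC)
  qed simp
  then show False using t by (simp add: spectrum_op_def)
qed

text \<open>The set over which \<open>cfc\<close> takes its uniform limits; for a self-adjoint
  operator it is the whole spectrum.\<close>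

definition real_spectrum :: "('a::complex_hilbert_space \<Rightarrow>\<^sub>L 'a) \<Rightarrow> real set" where
  "real_spectrum A = {t. complex_of_real t \<in> spectrum_op A}"

lemma spectrum_op_eq_real_spectrum:
  assumes "selfadjoint_op A"
  shows "spectrum_op A = complex_of_real ` real_spectrum A"
proof -
  have "z = complex_of_real (Re z)" if "z \<in> spectrum_op A" for z
    using spectrum_real[OF assms that] by (simp add: complex_eq_iff)
  then show ?thesis
    by (auto simp: real_spectrum_def image_iff) metis
qed

text \<open>If there were no real spectrum, \<open>form_nonneg_of_resolvent\<close> would apply to
  every shift of \<open>A\<close>, making every real \<open>s\<close> a lower bound of the form. A
  nonzero vector excludes the zero space, where the spectrum is empty.\<close>

lemma real_spectrum_nonempty:
  fixes A :: "'a::complex_hilbert_space \<Rightarrow>\<^sub>L 'a"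
  assumes A: "selfadjoint_op A" and x: "(x::'a) \<noteq> 0"
  shows "real_spectrum A \<noteq> {}"
proof
  assume "real_spectrum A = {}"
  then have inv: "invertible_op (A - scalar_op (complex_of_real t))" for t
    by (auto simp: real_spectrum_def spectrum_op_def)
  have "s * inner x x \<le> inner (A x) x" for s
  proof -
    have e: "A - s *\<^sub>R id_blinfun - scalar_op (complex_of_real l)
        = A - scalar_op (complex_of_real (s + l))" for l
      by (auto simp: blinfun.diff_left blinfun.minus_left blinfun.scaleR_left scaleC_add_left scaleR_scaleC
          intro!: blinfun_eqI)
    have "0 \<le> inner ((A - s *\<^sub>R id_blinfun) x) x"
      by (rule form_nonneg_of_resolvent)
        (auto simp: e inv A simp del: of_real_add
          intro!: selfadjoint_op_diff selfadjoint_op_scaleR selfadjoint_op_id)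
    then show ?thesis by (simp add: blinfun.diff_left blinfun.scaleR_left inner_diff_left)
  qed
  \<comment> \<open>This \<open>s\<close> would give
    \<open>inner (A x) x + 1 \<le> inner (A x) x\<close>.\<close>
  from this[of "(inner (A x) x + 1) / inner x x"] x show False by simp
qed

section \<open>Positivity and norm bounds for real polynomials of an operator\<close>

text \<open>Spectral mapping: if \<open>p(A) - l\<close> is not invertible, one of the linear factors of \<open>p - l\<close>
  has its root in the spectrum, so \<open>l\<close> is a value of \<open>p\<close> there.\<close>

lemma poly_op_nonneg:
  fixes A :: "'a::complex_hilbert_space \<Rightarrow>\<^sub>L 'a"
  assumes A: "selfadjoint_op A" and p: "\<And>t. t \<in> real_spectrum A \<Longrightarrow> 0 \<le> poly p t"
  shows "0 \<le> inner (poly_op p A x) x"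
proof (cases "x = 0")
  case False
  \<comment> \<open>\<open>t0\<close> shows below that \<open>q\<close> is not the zero polynomial,
    since \<open>poly q t0 \<noteq> 0\<close>.\<close>
  then obtain t0 where t0: "t0 \<in> real_spectrum A"
    using real_spectrum_nonempty[OF A] by blast
  show ?thesis
  proof (rule form_nonneg_of_resolvent[OF selfadjoint_poly_op[OF A]])
    fix l :: real
    assume l: "l < 0"
    define q where "q = p - [:l:]"
    have q: "poly q t \<noteq> 0" if "t \<in> real_spectrum A" for t
      using p[OF that] l by (simp add: q_def)
    have "poly_op p A - scalar_op (complex_of_real l) = poly_op q A"
      by (auto simp: q_def poly_op_diff poly_op_const blinfun.diff_left blinfun.scaleR_left
          scaleR_scaleC intro!: blinfun_eqI)
    also have "\<dots> = cpoly_op (map_poly of_real q) A"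
      by (rule poly_op_eq_cpoly_op)
    also have "invertible_op \<dots>"
    proof (rule invertible_cpoly_op)
      show "clinear_op A" using A by (simp add: selfadjoint_op_def)
      show "map_poly complex_of_real q \<noteq> 0"
        using q[OF t0] by (subst map_poly_eq_0_iff) auto
      have e: "poly (map_poly complex_of_real q) (complex_of_real t) = complex_of_real (poly q t)" for t
        by (induction q) (auto simp: map_poly_pCons)
      show "z \<notin> spectrum_op A" if "poly (map_poly complex_of_real q) z = 0" for z
      proof
        assume "z \<in> spectrum_op A"
        then obtain t where "t \<in> real_spectrum A" "z = complex_of_real t"
          using spectrum_op_eq_real_spectrum[OF A] by auto
        then show False using that q e by auto
      qed
    qed
    finally show "invertible_op (poly_op p A - scalar_op (complex_of_real l))" .
  qed
qed simp

text \<open>Polarization expresses \<open>inner (T x) y\<close> through the form at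
  \<open>x + y\<close> and \<open>x - y\<close>, and the parallelogram law adds up the two
  bounds.\<close>

lemma norm_selfadjoint_le:
  fixes T :: "'a::complex_hilbert_space \<Rightarrow>\<^sub>L 'a"
  assumes T: "selfadjoint_op T" and c: "0 \<le> c"
    and form: "\<And>x. \<bar>inner (T x) x\<bar> \<le> c * inner x x"
  shows "norm T \<le> c"
proof (rule norm_blinfun_bound[OF c])
  fix x
  show "norm (T x) \<le> c * norm x"
  proof (cases "T x = 0")
    case False
    then have x: "norm x > 0" by auto
    \<comment> \<open>\<open>T x\<close> rescaled to the length of \<open>x\<close>, so that the
      Cauchy-Schwarz inequality for \<open>inner (T x) y\<close> becomes an equality.\<close>
    define y where "y = (norm x / norm (T x)) *\<^sub>R T x"
    have y: "inner y y = inner x x"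
      using False by (simp add: y_def flip: power2_norm_eq_inner)
    have Txy: "inner (T x) y = norm x * norm (T x)"
      using False by (simp add: y_def power2_eq_square flip: power2_norm_eq_inner)
    have "4 * inner (T x) y = inner (T (x + y)) (x + y) - inner (T (x - y)) (x - y)"
      using T by (simp add: selfadjoint_op_def blinfun.add_right blinfun.diff_right inner_simps inner_commute)
    also have "\<dots> \<le> c * inner (x + y) (x + y) + c * inner (x - y) (x - y)"
      using form[of "x + y"] form[of "x - y"] by linarith
    also have "\<dots> = 4 * (c * inner x x)"
      using y by (simp add: inner_simps inner_commute algebra_simps)
    finally have "norm x * norm (T x) \<le> norm x * (c * norm x)"
      by (simp add: Txy power2_eq_square mult.left_commute flip: power2_norm_eq_inner)
    then show ?thesis using x by simp
  qed (use c in simp)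
qed

text \<open>Both \<open>c - p\<close> and \<open>c + p\<close> are nonnegative on the spectrum, so
  \<open>poly_op_nonneg\<close> bounds the form on both sides. This makes \<open>poly_op\<close>
  continuous for uniform convergence on the spectrum.\<close>

lemma norm_poly_op_le:
  fixes A :: "'a::complex_hilbert_space \<Rightarrow>\<^sub>L 'a"
  assumes A: "selfadjoint_op A" and c: "0 \<le> c"
    and p: "\<And>t. t \<in> real_spectrum A \<Longrightarrow> \<bar>poly p t\<bar> \<le> c"
  shows "norm (poly_op p A) \<le> c"
proof (rule norm_selfadjoint_le[OF selfadjoint_poly_op[OF A] c])
  fix x
  have "0 \<le> inner (poly_op ([:c:] - p) A x) x" "0 \<le> inner (poly_op ([:c:] + p) A x) x"
    by (rule poly_op_nonneg[OF A]; use p in \<open>force simp: abs_le_iff\<close>)+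
  then show "\<bar>inner (poly_op p A x) x\<bar> \<le> c * inner x x"
    by (simp add: poly_op_diff poly_op_add poly_op_const blinfun.diff_left blinfun.add_left
        blinfun.scaleR_left inner_diff_left inner_add_left abs_le_iff)
qed

section \<open>The continuous functional calculus\<close>

lemma Weierstrass_poly:
  fixes f :: "real \<Rightarrow> real"
  assumes "continuous_on {a..b} f"
  obtains p :: "nat \<Rightarrow> real poly" where "uniform_limit {a..b} (\<lambda>n. poly (p n)) f sequentially"
proof -
  obtain g where g: "uniform_limit {a..b} g f sequentially" "\<And>n. polynomial_function (g n :: real \<Rightarrow> real)"
    using Stone_Weierstrass_uniform_limit[OF compact_Icc assms] by blast
  have "\<exists>p. g n = poly p" for n
  proof -
    have "real_polynomial_function (g n)"
      using g(2) by (simp add: real_polynomial_function_eq)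
    then obtain c d where "g n = (\<lambda>x. \<Sum>i\<le>d. c i * x ^ i)"
      using real_polynomial_function_imp_sum by blast
    then have "g n = poly (\<Sum>i\<le>d. monom (c i) i)"
      by (simp add: poly_sum poly_monom fun_eq_iff)
    then show ?thesis by blast
  qed
  then obtain p where "\<And>n. g n = poly (p n)" by metis
  then have "g = (\<lambda>n. poly (p n))" by auto
  then show ?thesis using g(1) that by blast
qed

text \<open>With \<open>q = p\<close> this is the Cauchy property of the operators
  \<open>poly_op (p n) A\<close>; with two different sequences it shows that their limit depends on
  \<open>f\<close> alone.\<close>

lemma poly_op_diff_tendsto_zero:
  fixes A :: "'a::complex_hilbert_space \<Rightarrow>\<^sub>L 'a"
  assumes A: "selfadjoint_op A"
    and p: "uniform_limit (real_spectrum A) (\<lambda>n. poly (p n)) f sequentially"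
    and q: "uniform_limit (real_spectrum A) (\<lambda>n. poly (q n)) f sequentially"
    and e: "e > 0"
  shows "\<exists>N. \<forall>m\<ge>N. \<forall>n\<ge>N. norm (poly_op (p m) A - poly_op (q n) A) < e"
proof -
  have "\<forall>\<^sub>F n in sequentially. \<forall>t\<in>real_spectrum A. dist (poly (p n) t) (f t) < e / 4"
    "\<forall>\<^sub>F n in sequentially. \<forall>t\<in>real_spectrum A. dist (poly (q n) t) (f t) < e / 4"
    using uniform_limitD[OF p, of "e / 4"] uniform_limitD[OF q, of "e / 4"] e by simp_all
  then obtain N1 N2 where
    N1: "\<And>n t. n \<ge> N1 \<Longrightarrow> t \<in> real_spectrum A \<Longrightarrow> dist (poly (p n) t) (f t) < e / 4" and
    N2: "\<And>n t. n \<ge> N2 \<Longrightarrow> t \<in> real_spectrum A \<Longrightarrow> dist (poly (q n) t) (f t) < e / 4"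
    unfolding eventually_sequentially by blast
  have "norm (poly_op (p m) A - poly_op (q n) A) < e" if "m \<ge> max N1 N2" "n \<ge> max N1 N2" for m n
  proof -
    \<comment> \<open>The two errors of \<open>e / 4\<close> add up to \<open>e / 2\<close>, which
      leaves room for the strict inequality.\<close>
    have "norm (poly_op (p m - q n) A) \<le> e / 2"
    proof (rule norm_poly_op_le[OF A])
      fix t
      assume t: "t \<in> real_spectrum A"
      show "\<bar>poly (p m - q n) t\<bar> \<le> e / 2"
        using N1[of m t] N2[of n t] t that by (simp add: dist_real_def abs_if split: if_splits)
    qed (use e in simp)
    then show ?thesis using e by (simp add: poly_op_diff)
  qed
  then show ?thesis by blast
qed

text \<open>The description in \<open>cfc\<close> is well defined: completeness gives a limit
  \<open>T\<close> along a Weierstrass sequence \<open>q\<close>, all other approximating sequences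
  share this limit, and any candidate agrees with \<open>T\<close> along \<open>q\<close>.\<close>

lemma poly_op_tendsto_cfc:
  fixes A :: "'a::complex_hilbert_space \<Rightarrow>\<^sub>L 'a"
  assumes A: "selfadjoint_op A" and sub: "real_spectrum A \<subseteq> {a..b}" and f: "continuous_on {a..b} f"
    and p: "uniform_limit (real_spectrum A) (\<lambda>n. poly (p n)) f sequentially"
  shows "(\<lambda>n. poly_op (p n) A) \<longlonglongrightarrow> cfc f A"
proof -
  obtain q where "uniform_limit {a..b} (\<lambda>n. poly (q n)) f sequentially"
    using Weierstrass_poly[OF f] .
  then have q: "uniform_limit (real_spectrum A) (\<lambda>n. poly (q n)) f sequentially"
    using sub by (rule uniform_limit_on_subset)
  have "Cauchy (\<lambda>n. poly_op (q n) A)"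
    using poly_op_diff_tendsto_zero[OF A q q] by (simp add: Cauchy_def dist_norm)
  then obtain T where T: "(\<lambda>n. poly_op (q n) A) \<longlonglongrightarrow> T"
    using Cauchy_convergent convergent_def by blast
  have lim: "(\<lambda>n. poly_op (p n) A) \<longlonglongrightarrow> T"
    if "uniform_limit (real_spectrum A) (\<lambda>n. poly (p n)) f sequentially" for p
  proof -
    have "(\<lambda>n. poly_op (p n) A - poly_op (q n) A) \<longlonglongrightarrow> 0"
      unfolding lim_sequentially using poly_op_diff_tendsto_zero[OF A that q] by (auto simp: dist_norm) blast
    from tendsto_add[OF this T] show ?thesis by simp
  qed
  have "cfc f A = T"
    unfolding cfc_def real_spectrum_def[symmetric]
  proof (rule the_equality)
    show "\<forall>p. uniform_limit (real_spectrum A) (\<lambda>n. poly (p n)) f sequentially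
        \<longrightarrow> (\<lambda>n. poly_op (p n) A) \<longlonglongrightarrow> T"
      using lim by blast
    show "T' = T" if "\<forall>p. uniform_limit (real_spectrum A) (\<lambda>n. poly (p n)) f sequentially
        \<longrightarrow> (\<lambda>n. poly_op (p n) A) \<longlonglongrightarrow> T'" for T'
      using that q T LIMSEQ_unique by blast
  qed
  then show ?thesis using lim[OF p] by simp
qed

lemma selfadjoint_cfc:
  fixes A :: "'a::complex_hilbert_space \<Rightarrow>\<^sub>L 'a"
  assumes A: "selfadjoint_op A" and sub: "real_spectrum A \<subseteq> {a..b}" and f: "continuous_on {a..b} f"
  shows "selfadjoint_op (cfc f A)"
proof -
  obtain p where "uniform_limit {a..b} (\<lambda>n. poly (p n)) f sequentially"
    using Weierstrass_poly[OF f] .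
  from poly_op_tendsto_cfc[OF A sub f uniform_limit_on_subset[OF this sub]]
  show ?thesis by (intro selfadjoint_op_limit[OF selfadjoint_poly_op[OF A]])
qed

text \<open>Monotonicity of the calculus, with the affine part written out as
  \<open>inner (A x) x\<close> and \<open>inner x x\<close> so that the inequalities for several
  operators can be added.\<close>

lemma cfc_affine_form_nonneg:
  fixes A :: "'a::complex_hilbert_space \<Rightarrow>\<^sub>L 'a"
  assumes A: "selfadjoint_op A" and sub: "real_spectrum A \<subseteq> {a..b}" and f: "continuous_on {a..b} f"
    and nonneg: "\<And>t. t \<in> real_spectrum A \<Longrightarrow> 0 \<le> s * f t + k * t + l"
  shows "0 \<le> s * inner (cfc f A x) x + k * inner (A x) x + l * inner x x"
proof -
  obtain p where "uniform_limit {a..b} (\<lambda>n. poly (p n)) f sequentially"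
    using Weierstrass_poly[OF f] .
  then have p: "uniform_limit (real_spectrum A) (\<lambda>n. poly (p n)) f sequentially"
    using sub by (rule uniform_limit_on_subset)
  note lim = poly_op_tendsto_cfc[OF A sub f p]
  \<comment> \<open>A polynomial within \<open>e\<close> of \<open>f\<close> may push the
    combination down by \<open>\<bar>s\<bar> * e\<close>; raising the constant term by that amount
    restores nonnegativity. Afterwards \<open>e\<close> tends to 0.\<close>
  have approx: "0 \<le> s * inner (cfc f A x) x + k * inner (A x) x + (l + \<bar>s\<bar> * e) * inner x x"
    if e: "e > 0" for e
  proof (rule tendsto_lowerbound)
    show "(\<lambda>n. s * inner (poly_op (p n) A x) x + k * inner (A x) x + (l + \<bar>s\<bar> * e) * inner x x)
        \<longlonglongrightarrow> s * inner (cfc f A x) x + k * inner (A x) x + (l + \<bar>s\<bar> * e) * inner x x"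
      by (intro tendsto_intros lim)
    show "\<forall>\<^sub>F n in sequentially.
        0 \<le> s * inner (poly_op (p n) A x) x + k * inner (A x) x + (l + \<bar>s\<bar> * e) * inner x x"
      using uniform_limitD[OF p e]
    proof eventually_elim
      case (elim n)
      have "0 \<le> inner (poly_op (smult s (p n) + [:l + \<bar>s\<bar> * e, k:]) A x) x"
      proof (rule poly_op_nonneg[OF A])
        fix t
        assume t: "t \<in> real_spectrum A"
        have "\<bar>poly (p n) t - f t\<bar> \<le> e"
          using elim t by (auto simp: dist_real_def less_imp_le)
        then have "\<bar>s * (poly (p n) t - f t)\<bar> \<le> \<bar>s\<bar> * e"
          by (simp add: abs_mult mult_left_mono)
        then have "s * f t - \<bar>s\<bar> * e \<le> s * poly (p n) t"
          by (simp add: abs_le_iff algebra_simps)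
        then show "0 \<le> poly (smult s (p n) + [:l + \<bar>s\<bar> * e, k:]) t"
          using nonneg[OF t] by (simp add: algebra_simps)
      qed
      then show ?case
        by (simp add: poly_op_add poly_op_smult poly_op_linear blinfun.add_left blinfun.scaleR_left
            inner_add_left add.assoc)
    qed
  qed simp
  show ?thesis
  proof (rule tendsto_lowerbound)
    show "((\<lambda>e. s * inner (cfc f A x) x + k * inner (A x) x + (l + \<bar>s\<bar> * e) * inner x x)
        \<longlongrightarrow> s * inner (cfc f A x) x + k * inner (A x) x + l * inner x x) (at_right 0)"
      by (auto intro!: tendsto_eq_intros)
    show "\<forall>\<^sub>F e in at_right 0.
        0 \<le> s * inner (cfc f A x) x + k * inner (A x) x + (l + \<bar>s\<bar> * e) * inner x x"
      using eventually_at_right_less[of "0::real"] by eventually_elim (rule approx)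
  qed simp
qed

section \<open>Chords and tangents of convex functions\<close>

lemma convex_secant:
  fixes f f' :: "real \<Rightarrow> real"
  assumes convex: "convex_on {0<..} f"
    and deriv: "\<And>t. t > 0 \<Longrightarrow> (f has_real_derivative f' t) (at t)"
    and m: "0 < m" "m \<le> M"
  obtains k l where "\<And>t. t \<in> {m..M} \<Longrightarrow> f t \<le> k * t + l"
    and "\<And>t. 0 < t \<Longrightarrow> t \<notin> {m<..<M} \<Longrightarrow> k * t + l \<le> f t"
proof (cases "m = M")
  case True
  \<comment> \<open>For \<open>m = M\<close> the open interval is empty, and the tangent at
    \<open>m\<close> lies below \<open>f\<close> on the whole positive half-line.\<close>
  have "f' m * (t - m) \<le> f t - f m" if "0 < t" for t
    using deriv[of m] m that
    by (intro convex_on_imp_above_tangent[OF convex])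
      (auto simp: interior_open intro: has_field_derivative_at_within)
  then show ?thesis
    using True by (intro that[of "f' m" "f m - f' m * m"]) (auto simp: algebra_simps)
next
  case False
  then have mM: "m < M" using m by simp
  define k where "k = (f M - f m) / (M - m)"
  \<comment> \<open>The orientation of the quotient in which \<open>convex_on_slope_le\<close>
    yields it.\<close>
  have k: "k = (f m - f M) / (m - M)"
    by (metis k_def minus_diff_eq minus_divide_divide)
  have M: "f M = k * M + (f m - k * m)"
  proof -
    have "k * (M - m) = f M - f m" using mM by (simp add: k_def)
    then show ?thesis by (simp add: right_diff_distrib)
  qed
  show ?thesis
  proof (rule that[of k "f m - k * m"])
    show "f t \<le> k * t + (f m - k * m)" if "t \<in> {m..M}" for t
    proof -
      have "convex_on {m..M} f"
        by (rule convex_on_subset[OF convex]) (use m in auto)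
      then have "f t \<le> k * (t - m) + f m"
        unfolding k_def using that by (rule convex_onD_Icc')
      then show ?thesis by (simp add: algebra_simps)
    qed
    show "k * t + (f m - k * m) \<le> f t" if t: "0 < t" "t \<notin> {m<..<M}" for t
    proof -
      \<comment> \<open>Slopes of chords of a convex function increase, so to the left of
        \<open>m\<close> and to the right of \<open>M\<close> the graph runs above the line; at
        \<open>m\<close> and \<open>M\<close> it meets the line.\<close>
      consider "t < m" | "t = m" | "t = M" | "t > M" using t by force
      then show ?thesis
      proof cases
        case 1
        then have "(f t - f m) / (t - m) \<le> k"
          using convex_on_slope_le[OF convex, of t M m] mM m t k by auto
        then show ?thesis using 1 by (simp add: field_simps)
      next
        case 4
        then have "k \<le> (f M - f t) / (M - t)"
          using convex_on_slope_le[OF convex, of m t M] mM m t k by auto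
        then have "f M + k * (t - M) \<le> f t" using 4 by (simp add: field_simps)
        then show ?thesis using M by (simp add: algebra_simps)
      qed (use M in auto)
    qed
  qed
qed

section \<open>The interval \<open>tau\<close> and the spectra of strictly positive
  operators\<close>

lemma real_spectrum_subset_tau: "real_spectrum A \<subseteq> tau A"
  by (auto simp: real_spectrum_def tau_def)

text \<open>An interval \<open>{a..b}\<close> that covers the spectrum has \<open>a\<close> as a
  lower and \<open>b\<close> as an upper bound of it, and \<open>tau\<close> is the intersection of
  such intervals. On an empty set, \<open>Inf\<close> and \<open>Sup\<close> would carry no
  information.\<close>

lemma Icc_subset_tau:
  assumes "real_spectrum A \<noteq> {}"
  shows "{Inf (real_spectrum A)..Sup (real_spectrum A)} \<subseteq> tau A"
proof -
  have sub: "{Inf (real_spectrum A)..Sup (real_spectrum A)} \<subseteq> {a..b}"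
    if "spectrum_op A \<subseteq> complex_of_real ` {a..b}" for a b
  proof -
    have "a \<le> t \<and> t \<le> b" if "t \<in> real_spectrum A" for t
      using that \<open>spectrum_op A \<subseteq> _\<close> by (auto simp: real_spectrum_def)
    then show ?thesis
      using assms by (auto intro: order_trans[OF cInf_greatest] order_trans[OF _ cSup_least])
  qed
  show ?thesis
    unfolding tau_def by (rule Inter_greatest) (use sub in blast)
qed

text \<open>The scalar \<open>r\<close> factors out of the shifted operator. With
  \<open>r = 1 / 2\<close> this links the spectrum of the mean to that of
  \<open>A + B\<close>.\<close>

lemma real_spectrum_scaleR_iff:
  assumes "r \<noteq> 0"
  shows "r * t \<in> real_spectrum (r *\<^sub>R A) \<longleftrightarrow> t \<in> real_spectrum A"
proof -
  have "r *\<^sub>R A - scalar_op (complex_of_real (r * t))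
      = scalar_op (complex_of_real r) o\<^sub>L (A - scalar_op (complex_of_real t))"
    by (auto simp: blinfun.diff_left blinfun.scaleR_left scaleC_diff_right scaleC_scaleC scaleR_scaleC
        intro!: blinfun_eqI)
  then show ?thesis
    using assms by (simp add: real_spectrum_def spectrum_op_def invertible_op_scalar_compose
        del: of_real_mult)
qed

lemma strictly_positive_op_coercive:
  assumes "strictly_positive_op A"
  obtains c where "selfadjoint_op A" "c > 0" "\<And>x. c * (norm x)\<^sup>2 \<le> inner (A x) x"
  using assms positive_invertible_coercive[of A]
  unfolding strictly_positive_op_def positive_op_iff by metis

text \<open>The positive lower end \<open>c\<close> keeps the spectrum in an interval on which all
  real powers are continuous.\<close>

lemma strictly_positive_op_spectrum:
  assumes "strictly_positive_op A"
  obtains c where "selfadjoint_op A" "c > 0" "real_spectrum A \<subseteq> {c..norm A}"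
proof -
  obtain c where A: "selfadjoint_op A" and "c > 0" and c: "\<And>x. c * (norm x)\<^sup>2 \<le> inner (A x) x"
    using assms strictly_positive_op_coercive by metis
  moreover have "real_spectrum A \<subseteq> {c..norm A}"
    using spectrum_lower_bound[OF A c] spectrum_upper_bound[OF A]
    by (auto simp: real_spectrum_def)
  ultimately show ?thesis using that by blast
qed

lemma coercive_strictly_positive_op:
  assumes "selfadjoint_op A" "c > 0" "\<And>x. c * (norm x)\<^sup>2 \<le> inner (A x) x"
  shows "strictly_positive_op A"
proof -
  have "0 \<le> inner (A x) x" for x
    by (rule order_trans[OF _ assms(3)]) (use assms(2) in simp)
  then show ?thesis
    using assms coercive_invertible[of A c]
    by (simp add: strictly_positive_op_def positive_op_iff selfadjoint_op_def)
qed

text \<open>Sums of invertible operators may fail to be invertible, but coercivity constants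
  add.\<close>

lemma strictly_positive_op_add:
  assumes "strictly_positive_op A" "strictly_positive_op B"
  shows "strictly_positive_op (A + B)"
proof -
  obtain a where A: "selfadjoint_op A" and a: "a > 0" and Aa: "\<And>x. a * (norm x)\<^sup>2 \<le> inner (A x) x"
    using assms(1) strictly_positive_op_coercive by metis
  obtain b where B: "selfadjoint_op B" and b: "b > 0" and Bb: "\<And>x. b * (norm x)\<^sup>2 \<le> inner (B x) x"
    using assms(2) strictly_positive_op_coercive by metis
  show ?thesis
  proof (rule coercive_strictly_positive_op)
    show "0 < a + b" using a b by simp
  qed (use A B Aa Bb in \<open>auto intro: selfadjoint_op_add add_mono
        simp: blinfun.add_left inner_add_left distrib_right\<close>)
qed

section \<open>Operator powers and the mean inequality\<close>

lemma convex_on_signed_powr: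
  fixes r s :: real
  assumes "0 \<le> s * r * (r - 1)"
  shows "convex_on {0<..} (\<lambda>t. s * t powr r)"
proof (rule f''_ge0_imp_convex)
  fix t :: real
  assume "t \<in> {0<..}"
  then show "((\<lambda>t. s * t powr r) has_real_derivative s * (r * t powr (r - 1))) (at t)"
    "((\<lambda>t. s * (r * t powr (r - 1))) has_real_derivative s * (r * ((r - 1) * t powr (r - 1 - 1)))) (at t)"
    by (auto intro!: derivative_eq_intros)
  show "0 \<le> s * (r * ((r - 1) * t powr (r - 1 - 1)))"
    using mult_nonneg_nonneg[OF assms powr_ge_zero[of t "r - 1 - 1"]] by (simp add: mult.assoc)
qed simp

text \<open>The sign \<open>s\<close> unites both halves of the claim: the hypothesis on it makes
  the second derivative of \<open>s * t powr r\<close> nonnegative, with \<open>s = 1\<close> for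
  \<open>r\<close> outside the unit interval and \<open>s = -1\<close> inside.\<close>

lemma powr_op_mean_form:
  fixes A B :: "'a::complex_hilbert_space \<Rightarrow>\<^sub>L 'a"
  assumes "strictly_positive_op A" "strictly_positive_op B"
    and tauA: "tau A \<inter> tau ((1 / 2) *\<^sub>R (A + B)) = {}"
    and tauB: "tau B \<inter> tau ((1 / 2) *\<^sub>R (A + B)) = {}"
    and s: "0 \<le> s * r * (r - 1)"
  shows "s * (2 powr (1 - r) * inner (powr_op (A + B) r x) x)
      \<le> s * (inner (powr_op A r x) x + inner (powr_op B r x) x)"
proof -
  obtain a where A: "selfadjoint_op A" and a: "a > 0" and subA: "real_spectrum A \<subseteq> {a..norm A}"
    using assms(1) strictly_positive_op_spectrum by metis
  obtain b where B: "selfadjoint_op B" and b: "b > 0" and subB: "real_spectrum B \<subseteq> {b..norm B}"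
    using assms(2) strictly_positive_op_spectrum by metis
  obtain c where AB: "selfadjoint_op (A + B)" and c: "c > 0"
    and subAB: "real_spectrum (A + B) \<subseteq> {c..norm (A + B)}"
    using assms(1,2) strictly_positive_op_add strictly_positive_op_spectrum by metis
  define D where "D = (1 / 2) *\<^sub>R (A + B)"
  have half: "t / 2 \<in> real_spectrum D \<longleftrightarrow> t \<in> real_spectrum (A + B)" for t
    using real_spectrum_scaleR_iff[of "1 / 2" t "A + B"] by (simp add: D_def)
  \<comment> \<open>For nonempty spectrum, \<open>m\<close> and \<open>M\<close> are the ends of the
    convex hull of the spectrum of \<open>D\<close>. This hull lies in \<open>tau D\<close>, so the
    spectra of \<open>A\<close> and \<open>B\<close> stay out of it.\<close>
  obtain m M where mM: "0 < m" "m \<le> M" "real_spectrum D \<subseteq> {m..M}"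
    "real_spectrum A \<inter> {m<..<M} = {}" "real_spectrum B \<inter> {m<..<M} = {}"
  proof (cases "real_spectrum D = {}")
    case True
    \<comment> \<open>Empty spectrum means the zero space; a positive one-point interval then meets
      all conditions.\<close>
    then show ?thesis by (intro that[of 1 1]) auto
  next
    case False
    have D: "c / 2 \<le> t \<and> t \<le> norm (A + B) / 2" if "t \<in> real_spectrum D" for t
      using subAB half[of "2 * t"] that by auto
    then have bdd: "bdd_below (real_spectrum D)" "bdd_above (real_spectrum D)"
      unfolding bdd_below_def bdd_above_def by blast+
    let ?I = "Inf (real_spectrum D)" and ?S = "Sup (real_spectrum D)"
    have DI: "real_spectrum D \<subseteq> {?I..?S}"
      using bdd by (auto intro: cInf_lower cSup_upper)
    have "c / 2 \<le> ?I" using False D by (intro cInf_greatest) auto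
    then have "0 < ?I" using c by auto
    moreover have "?I \<le> ?S" using False DI by fastforce
    moreover have "{?I<..<?S} \<subseteq> tau D"
      using Icc_subset_tau[OF False] by auto
    ultimately show ?thesis
      using that DI tauA tauB real_spectrum_subset_tau[of A] real_spectrum_subset_tau[of B]
      unfolding D_def[symmetric] by blast
  qed
  obtain k l where upper: "\<And>t. t \<in> {m..M} \<Longrightarrow> s * t powr r \<le> k * t + l"
    and lower: "\<And>t. 0 < t \<Longrightarrow> t \<notin> {m<..<M} \<Longrightarrow> k * t + l \<le> s * t powr r"
  proof (rule convex_secant[OF convex_on_signed_powr[OF s] _ mM(1,2)])
    show "((\<lambda>t. s * t powr r) has_real_derivative s * (r * t powr (r - 1))) (at t)" if "t > 0" for t
      using that by (auto intro!: derivative_eq_intros)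
  qed blast
  have cont: "continuous_on {c..d} (\<lambda>t. t powr r)" if "0 < c" for c d :: real
    using that by (intro continuous_intros) auto
  have "0 \<le> s * inner (powr_op A r x) x + (- k) * inner (A x) x + (- l) * inner x x"
    unfolding powr_op_def
  proof (rule cfc_affine_form_nonneg[OF A subA cont[OF a]])
    show "0 \<le> s * t powr r + (- k) * t + (- l)" if "t \<in> real_spectrum A" for t
      using lower[of t] that subA mM a by force
  qed
  moreover have "0 \<le> s * inner (powr_op B r x) x + (- k) * inner (B x) x + (- l) * inner x x"
    unfolding powr_op_def
  proof (rule cfc_affine_form_nonneg[OF B subB cont[OF b]])
    show "0 \<le> s * t powr r + (- k) * t + (- l)" if "t \<in> real_spectrum B" for t
      using lower[of t] that subB mM b by force
  qed
  \<comment> \<open>Twice the chord inequality for the mean at \<open>t / 2\<close>, read on the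
    spectrum of \<open>A + B\<close>; the factor \<open>2 powr (1 - r)\<close> comes from
    \<open>2 * (t / 2) powr r\<close>.\<close>
  moreover have "0 \<le> (- (s * 2 powr (1 - r))) * inner (powr_op (A + B) r x) x
      + k * inner ((A + B) x) x + (2 * l) * inner x x"
    unfolding powr_op_def
  proof (rule cfc_affine_form_nonneg[OF AB subAB cont[OF c]])
    fix t
    assume t: "t \<in> real_spectrum (A + B)"
    then have "0 < t" using subAB c by auto
    then have "2 powr (1 - r) * t powr r = 2 * (t / 2) powr r"
      by (simp add: powr_divide powr_diff)
    moreover have "s * (t / 2) powr r \<le> k * (t / 2) + l"
      using half[of t] t mM(3) by (intro upper) auto
    ultimately show "0 \<le> - (s * 2 powr (1 - r)) * t powr r + k * t + 2 * l"
      by (simp add: mult.assoc)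
  qed
  \<comment> \<open>In the sum of the three inequalities all terms with \<open>k\<close> and
    \<open>l\<close> cancel.\<close>
  ultimately show ?thesis
    by (simp add: blinfun.add_left inner_add_left algebra_simps)
qed

lemma selfadjoint_powr_op:
  assumes "strictly_positive_op A"
  shows "selfadjoint_op (powr_op A r)"
proof -
  obtain c where A: "selfadjoint_op A" and c: "c > 0" and sub: "real_spectrum A \<subseteq> {c..norm A}"
    using assms strictly_positive_op_spectrum by metis
  show ?thesis
    unfolding powr_op_def
    by (rule selfadjoint_cfc[OF A sub]) (use c in \<open>auto intro!: continuous_intros\<close>)
qed

theorem corollary2p2:
  fixes A B :: "'a::complex_hilbert_space \<Rightarrow>\<^sub>L 'a"
  assumes "strictly_positive_op A" and "strictly_positive_op B"
    and "tau A \<inter> tau ((1 / 2) *\<^sub>R (A + B)) = {}"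
    and "tau B \<inter> tau ((1 / 2) *\<^sub>R (A + B)) = {}"
  shows "(\<forall>r::real. r > 1 \<or> r < 0 \<longrightarrow>
            (2 powr (1 - r)) *\<^sub>R powr_op (A + B) r \<preceq> powr_op A r + powr_op B r) \<and>
         (\<forall>r::real. r \<in> {0..1} \<longrightarrow>
            powr_op A r + powr_op B r \<preceq> (2 powr (1 - r)) *\<^sub>R powr_op (A + B) r)"
proof -
  \<comment> \<open>By \<open>positive_op_iff\<close>, the order \<open>\<preceq>\<close> demands
    self-adjointness of the difference besides a nonnegative form.\<close>
  have sa: "selfadjoint_op (powr_op A r + powr_op B r)"
    "selfadjoint_op ((2 powr (1 - r)) *\<^sub>R powr_op (A + B) r)" for r
    using assms(1,2) strictly_positive_op_add
    by (auto intro!: selfadjoint_op_add selfadjoint_op_scaleR selfadjoint_powr_op)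
  note form = powr_op_mean_form[OF assms]
  have "(2 powr (1 - r)) *\<^sub>R powr_op (A + B) r \<preceq> powr_op A r + powr_op B r" if "r > 1 \<or> r < 0" for r
    unfolding le_op_def positive_op_iff
  proof (intro conjI allI)
    fix x
    \<comment> \<open>Here \<open>s = 1\<close>, since \<open>t powr r\<close> itself is
      convex.\<close>
    have "0 \<le> 1 * r * (r - 1)" using that by (auto simp: zero_le_mult_iff)
    from form[OF this, of x]
    show "0 \<le> inner ((powr_op A r + powr_op B r - (2 powr (1 - r)) *\<^sub>R powr_op (A + B) r) x) x"
      by (simp add: blinfun.add_left blinfun.diff_left blinfun.scaleR_left inner_simps)
  qed (intro selfadjoint_op_diff sa)
  moreover have "powr_op A r + powr_op B r \<preceq> (2 powr (1 - r)) *\<^sub>R powr_op (A + B) r" if "r \<in> {0..1}" for r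
    unfolding le_op_def positive_op_iff
  proof (intro conjI allI)
    fix x
    \<comment> \<open>Here \<open>s = -1\<close>, since \<open>t powr r\<close> is concave; the sign
      reverses the inequality.\<close>
    have "0 \<le> (- 1) * r * (r - 1)" using that by (auto simp: mult_le_0_iff)
    from form[OF this, of x]
    show "0 \<le> inner (((2 powr (1 - r)) *\<^sub>R powr_op (A + B) r - (powr_op A r + powr_op B r)) x) x"
      by (simp add: blinfun.add_left blinfun.diff_left blinfun.scaleR_left inner_simps)
  qed (intro selfadjoint_op_diff sa)
  ultimately show ?thesis by blast
qed

end
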